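(* Fix an input $x$, let $q_L(x)\in\Delta^{K-1}$ be a reference distribution, let $j=j(x)\in\arg\max_k q_L(k\mid x)$ and $\alpha=\alpha(x)=q_L(j\mid x)$, and let $$\mathcal Q_\alpha(x)=\{q\in\Delta^{K-1}:q_j\ge\alpha\}.$$ Let $p_-,p_+\in\Delta^{K-1}$ have strictly positive coordinates, and choose $k_{\min}\in\arg\min_k p_{-,k}$ and $k_{\max}\in\arg\max_k p_{+,k}$. Then, under the cross-entropy loss $\ell(p,q)=-\sum_{k=1}^K q_k\log p_k$, $$q_-^*=\alpha e_j+(1-\alpha)e_{k_{\min}}\in\arg\max_{q\in\mathcal Q_\alpha(x)}\ell(p_-,q),\qquad q_+^*=\alpha e_j+(1-\alpha)e_{k_{\max}}\in\arg\min_{q\in\mathcal Q_\alpha(x)}\ell(p_+,q).$$ These expressions also cover the cases $k_{\min}=j$ or $k_{\max}=j$, in which the corresponding target is $e_j$.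
   Context: $\Delta^{K-1}=\{q\in\mathbb R_{\ge0}^K:\sum_{k=1}^K q_k=1\}$ is the probability simplex over the classes $\{1,\dots,K\}$; $e_k$ is the $k$-th standard basis vector (all mass on class $k$); $q_L(k\mid x)$ is the $k$-th coordinate of $q_L(x)$. The set $\mathcal Q_\alpha(x)$ is the credal label; $p_-$ and $p_+$ are the predictions of a pessimistic head (trained on the maximum of the loss over the credal label) and an optimistic head (trained on the minimum). *)

theory Defs
  imports "HOL-Analysis.Analysis"
begin

(* The K classes are the elements of the finite index type 'k, so K = CARD('k). *)

definition prob_simplex :: "(real ^ 'k::finite) set" where
  "prob_simplex = {q. (\<forall>k. 0 \<le> q $ k) \<and> (\<Sum>k\<in>UNIV. q $ k) = 1}"

definition credal_label :: "'k::finite \<Rightarrow> real \<Rightarrow> (real ^ 'k) set" where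
  "credal_label j \<alpha> = {q \<in> prob_simplex. \<alpha> \<le> q $ j}"

(* First argument: prediction p; second argument: target q. Only meaningful for
   strictly positive p, since ln 0 = 0. *)
definition cross_entropy :: "real ^ 'k::finite \<Rightarrow> real ^ 'k \<Rightarrow> real" where
  "cross_entropy p q = - (\<Sum>k\<in>UNIV. q $ k * ln (p $ k))"

end

theory Submission
  imports Defs
begin

text \<open>For fixed \<open>p\<close> the loss is linear in \<open>q\<close>. If \<open>m\<close> maximises the coefficients \<open>c\<close> of a linear
  functional, then \<open>\<Sum>k. q $ k * (c k - c m) \<le> q $ j * (c j - c m) \<le> \<alpha> * (c j - c m)\<close>, since all
  factors \<open>c k - c m\<close> are nonpositive; that is the claimed bound. It is applied to
  \<open>c k = - ln (p_minus $ k)\<close> and to \<open>c k = ln (p_plus $ k)\<close>.\<close>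

lemma linear_le_credal_vertex:
  fixes q :: "real ^ 'k::finite" and c :: "'k \<Rightarrow> real"
  assumes q: "q \<in> credal_label j \<alpha>" and c: "\<And>k. c k \<le> c m"
  shows "(\<Sum>k\<in>UNIV. q $ k * c k) \<le> \<alpha> * c j + (1 - \<alpha>) * c m"
proof -
  have nonneg: "\<And>k. 0 \<le> q $ k"
    and total: "(\<Sum>k\<in>UNIV. q $ k) = 1" and qj: "\<alpha> \<le> q $ j"
    using q by (auto simp: credal_label_def prob_simplex_def)
  \<comment> \<open>Since \<open>q\<close> has total mass 1, subtracting \<open>c m\<close> from the
    functional shifts every coefficient by \<open>c m\<close>.\<close>
  have "(\<Sum>k\<in>UNIV. q $ k * c k) - c m = (\<Sum>k\<in>UNIV. q $ k * (c k - c m))"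
    using total by (simp add: right_diff_distrib sum_subtractf flip: sum_distrib_right)
  also have "\<dots> = q $ j * (c j - c m) + (\<Sum>k\<in>UNIV - {j}. q $ k * (c k - c m))"
    by (rule sum.remove) auto
  also have "\<dots> \<le> q $ j * (c j - c m)"
    using nonneg c by (auto intro!: sum_nonpos mult_nonneg_nonpos)
  also have "\<dots> \<le> \<alpha> * (c j - c m)"
    using qj c by (intro mult_right_mono_neg) auto
  finally show ?thesis by (simp add: algebra_simps)
qed

text \<open>The \<open>m\<close> term only adds nonnegative mass, so coordinate \<open>j\<close>
  keeps at least \<alpha>, and the case \<open>m = j\<close> needs no separate treatment.\<close>

lemma credal_vertex_mem:
  assumes "0 \<le> \<alpha>" "\<alpha> \<le> 1"
  shows "\<alpha> *\<^sub>R axis j 1 + (1 - \<alpha>) *\<^sub>R axis m 1 \<in> credal_label j \<alpha>"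
  using assms
  by (auto simp: credal_label_def prob_simplex_def axis_def sum.distrib sum_distrib_left[symmetric])

lemma cross_entropy_credal_vertex:
  "cross_entropy p (\<alpha> *\<^sub>R axis j 1 + (1 - \<alpha>) *\<^sub>R axis m 1)
     = - (\<alpha> * ln (p $ j) + (1 - \<alpha>) * ln (p $ m))"
proof -
  have "(\<Sum>k\<in>UNIV. axis i 1 $ k * ln (p $ k)) = ln (p $ i)" for i
    by (simp add: axis_def if_distrib[of "\<lambda>t. t * _"] cong: if_cong)
  then show ?thesis
    by (simp add: cross_entropy_def distrib_right sum.distrib mult.assoc flip: sum_distrib_left)
qed

theorem proposition2:
  fixes qL :: "'x \<Rightarrow> real ^ 'k::finite" and x :: 'x
    and j k_min k_max :: 'k and \<alpha> :: real
    and p_minus p_plus :: "real ^ 'k"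
  assumes "qL x \<in> prob_simplex"
    and "is_arg_max (\<lambda>k. qL x $ k) (\<lambda>k. k \<in> UNIV) j"
    and "\<alpha> = qL x $ j"
    and "p_minus \<in> prob_simplex" and "\<forall>k. 0 < p_minus $ k"
    and "p_plus \<in> prob_simplex" and "\<forall>k. 0 < p_plus $ k"
    and "is_arg_min (\<lambda>k. p_minus $ k) (\<lambda>k. k \<in> UNIV) k_min"
    and "is_arg_max (\<lambda>k. p_plus $ k) (\<lambda>k. k \<in> UNIV) k_max"
  shows "is_arg_max (cross_entropy p_minus) (\<lambda>q. q \<in> credal_label j \<alpha>)
           (\<alpha> *\<^sub>R axis j 1 + (1 - \<alpha>) *\<^sub>R axis k_min 1)
       \<and> is_arg_min (cross_entropy p_plus) (\<lambda>q. q \<in> credal_label j \<alpha>)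
           (\<alpha> *\<^sub>R axis j 1 + (1 - \<alpha>) *\<^sub>R axis k_max 1)
       \<and> (k_min = j \<longrightarrow> \<alpha> *\<^sub>R axis j 1 + (1 - \<alpha>) *\<^sub>R axis k_min 1 = (axis j 1 :: real ^ 'k))
       \<and> (k_max = j \<longrightarrow> \<alpha> *\<^sub>R axis j 1 + (1 - \<alpha>) *\<^sub>R axis k_max 1 = (axis j 1 :: real ^ 'k))"
proof -
  have "(\<Sum>k\<in>UNIV. qL x $ k) = 1" and nonneg: "\<And>k. 0 \<le> qL x $ k"
    using assms(1) by (auto simp: prob_simplex_def)
  \<comment> \<open>A single coordinate of a distribution is bounded by the total mass; this makes
    both vertices feasible.\<close>
  then have \<alpha>: "0 \<le> \<alpha>" "\<alpha> \<le> 1"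
    using member_le_sum[of j UNIV "($) (qL x)"] assms(3) by auto
  \<comment> \<open>On positive reals \<open>ln\<close> is monotone, so the least likely class
    carries the largest coefficient \<open>- ln\<close>.\<close>
  have le_minus: "- ln (p_minus $ k) \<le> - ln (p_minus $ k_min)" for k
    using assms(5,8) by (auto simp: is_arg_min_linorder)
  have le_plus: "ln (p_plus $ k) \<le> ln (p_plus $ k_max)" for k
    using assms(7,9) by (auto simp: is_arg_max_linorder)
  have "cross_entropy p_minus q
      \<le> cross_entropy p_minus (\<alpha> *\<^sub>R axis j 1 + (1 - \<alpha>) *\<^sub>R axis k_min 1)"
    if "q \<in> credal_label j \<alpha>" for q
    using linear_le_credal_vertex[OF that, of "\<lambda>k. - ln (p_minus $ k)", OF le_minus]
    unfolding cross_entropy_credal_vertex by (simp add: cross_entropy_def sum_negf)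
  \<comment> \<open>Minimising the loss means maximising its negation, whose coefficients are
    \<open>ln (p_plus $ k)\<close>.\<close>
  moreover have "cross_entropy p_plus (\<alpha> *\<^sub>R axis j 1 + (1 - \<alpha>) *\<^sub>R axis k_max 1)
      \<le> cross_entropy p_plus q"
    if "q \<in> credal_label j \<alpha>" for q
    using linear_le_credal_vertex[OF that, of "\<lambda>k. ln (p_plus $ k)", OF le_plus]
    unfolding cross_entropy_credal_vertex by (simp add: cross_entropy_def)
  \<comment> \<open>When the two classes coincide, the weights \<alpha> and 1 - \<alpha> merge into
    1 on the same basis vector.\<close>
  ultimately show ?thesis
    using credal_vertex_mem[OF \<alpha>]
    by (auto simp: is_arg_max_linorder is_arg_min_linorder simp flip: scaleR_left_distrib)
qed

end
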